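(* Let $L:A\to A$ be a derivation, let $q,b\in A$, let $\chi_0\in A$ be a particular solution of $(L+q)\chi=b$, and let $\eta\in A$ be any particular solution of $(L+q)\psi=0$, i.e. $\eta\in\operatorname{Ker}(L+q)$. Then the set $O$ of all solutions $\chi\in A$ of $(L+q)\chi=b$ is $$O=\chi_0+\operatorname{Ker}(L+q)=\chi_0+\eta\operatorname{Ker}L.$$
   Context: $A$ is a field of characteristic $0$, and $K\cong\mathbb{Q}$ is its subfield generated by $1$. $A$ is generated as a field by a set $\{x_1,\dots,x_n\}$ of $n$ distinct elements, different from $0$ and $1$, which is algebraically independent over $K$. $A$ is also assumed to carry a partial order $\le$ such that $\psi_1>\psi_2$ and $\varphi_1\ge\varphi_2$ imply $\psi_1+\varphi_1>\psi_2+\varphi_2$, and $\psi^2\ge 0$ for all $\psi\in A$. A derivation is a $K$-linear map $L:A\to A$ with $L(\psi\varphi)=\psi L\varphi+\varphi L\psi$. For $q\in A$, the operator $L+q:A\to A$ is $(L+q)\psi=L\psi+q\psi$; $\operatorname{Ker}$ denotes the set of elements of $A$ sent to $0$, and $\eta\operatorname{Ker}L=\{\eta\phi:\phi\in A,\ L\phi=0\}$.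
   Formalization: The solution η is additionally required to be nonzero whenever Ker(L+q) is not {0}; for η = 0 with a nonzero kernel (e.g. L = 0, q = 0) the second equality is false. *)

theory Defs
  imports Complex_Main "HOL-Library.Poly_Mapping" "HOL-Library.Set_Algebras"
begin

definition is_subfield :: "'a::field set \<Rightarrow> bool" where
  "is_subfield S \<longleftrightarrow>
     0 \<in> S \<and> 1 \<in> S \<and>
     (\<forall>a\<in>S. \<forall>b\<in>S. a + b \<in> S \<and> a * b \<in> S) \<and>
     (\<forall>a\<in>S. - a \<in> S \<and> inverse a \<in> S)"

definition generated_subfield :: "'a::field set \<Rightarrow> 'a set" where
  "generated_subfield X = is_subfield hull X"

text \<open>The copy of the rational numbers in a field of characteristic 0.\<close>

definition prime_field :: "'a::field set" where
  "prime_field = generated_subfield {1}"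

text \<open>
  Multivariate polynomials are finitely supported maps from monomials to coefficients; a monomial
  is a finitely supported map from variables to exponents. The variables are the elements
  themselves, and each one is evaluated at itself.
\<close>

definition eval_at_vars :: "(('a \<Rightarrow>\<^sub>0 nat) \<Rightarrow>\<^sub>0 'a) \<Rightarrow> 'a::field" where
  "eval_at_vars P =
     (\<Sum>m\<in>Poly_Mapping.keys P. Poly_Mapping.lookup P m *
        (\<Prod>v\<in>Poly_Mapping.keys m. v ^ Poly_Mapping.lookup m v))"

definition algebraically_independent_over :: "'a::field set \<Rightarrow> 'a set \<Rightarrow> bool" where
  "algebraically_independent_over K X \<longleftrightarrow>
     (\<forall>P :: ('a \<Rightarrow>\<^sub>0 nat) \<Rightarrow>\<^sub>0 'a.
        (\<forall>m. Poly_Mapping.lookup P m \<in> K) \<longrightarrow>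
        (\<forall>m\<in>Poly_Mapping.keys P. Poly_Mapping.keys m \<subseteq> X) \<longrightarrow>
        eval_at_vars P = 0 \<longrightarrow> P = 0)"

definition is_derivation_over :: "'a::field set \<Rightarrow> ('a \<Rightarrow> 'a) \<Rightarrow> bool" where
  "is_derivation_over K L \<longleftrightarrow>
     (\<forall>\<psi> \<phi>. L (\<psi> + \<phi>) = L \<psi> + L \<phi>) \<and>
     (\<forall>c\<in>K. \<forall>\<psi>. L (c * \<psi>) = c * L \<psi>) \<and>
     (\<forall>\<psi> \<phi>. L (\<psi> * \<phi>) = \<psi> * L \<phi> + \<phi> * L \<psi>)"

text \<open>The operator $L + q$, where $q$ stands for multiplication by $q$.\<close>

definition plus_mult_op :: "('a \<Rightarrow> 'a) \<Rightarrow> 'a \<Rightarrow> 'a \<Rightarrow> 'a::field" where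
  "plus_mult_op L q = (\<lambda>\<psi>. L \<psi> + q * \<psi>)"

definition Ker :: "('a \<Rightarrow> 'a::zero) \<Rightarrow> 'a set" where
  "Ker T = {\<psi>. T \<psi> = 0}"

end

theory Submission
  imports Defs
begin

text \<open>
  The first equality holds because $L + q$ is additive: two solutions of the inhomogeneous equation
  differ by an element of the kernel. The second follows from the identity
  $(L+q)(\eta\phi) = \phi\,(L+q)\eta + \eta\,L\phi$, which is the Leibniz rule. If
  $(L+q)\eta = 0$ and $\eta \neq 0$, it shows that $\eta\phi$ lies in the kernel of $L+q$ exactly
  when $\phi$ lies in the kernel of $L$, and every element of the field is of the form $\eta\phi$.
  If $\eta = 0$, the kernel of $L+q$ is zero by assumption, and both sides are $\{\chi_0\}$.
\<close>

lemma solutions_eq_particular_plus_Ker: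
  fixes T :: "'a::ab_group_add \<Rightarrow> 'a"
  assumes add: "\<And>\<psi> \<phi>. T (\<psi> + \<phi>) = T \<psi> + T \<phi>"
  shows "{\<chi>. T \<chi> = T \<chi>\<^sub>0} = \<chi>\<^sub>0 +o Ker T"
proof -
  have "T \<chi> = T \<chi>\<^sub>0 \<longleftrightarrow> T (\<chi> - \<chi>\<^sub>0) = 0" for \<chi>
    using add[of "\<chi> - \<chi>\<^sub>0" \<chi>\<^sub>0] by simp
  moreover have "\<chi> \<in> \<chi>\<^sub>0 +o Ker T \<longleftrightarrow> \<chi> - \<chi>\<^sub>0 \<in> Ker T" for \<chi>
    using set_minus_plus[of \<chi> \<chi>\<^sub>0 "Ker T"] by simp
  ultimately show ?thesis
    by (simp add: set_eq_iff Ker_def)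
qed

lemma plus_mult_op_mult:
  assumes "is_derivation_over K L"
  shows "plus_mult_op L q (\<eta> * \<phi>) = \<phi> * plus_mult_op L q \<eta> + \<eta> * L \<phi>"
  using assms by (simp add: is_derivation_over_def plus_mult_op_def algebra_simps)

lemma zero_in_Ker_derivation:
  assumes "is_derivation_over K L"
  shows "0 \<in> Ker L"
proof -
  have "L (0 * 0) = 0 * L 0 + 0 * L 0"
    using assms unfolding is_derivation_over_def by blast
  then show ?thesis
    by (simp add: Ker_def)
qed

lemma Ker_plus_mult_op:
  assumes deriv: "is_derivation_over K L"
    and hom: "\<eta> \<in> Ker (plus_mult_op L q)"
    and nontrivial: "Ker (plus_mult_op L q) \<noteq> {0} \<Longrightarrow> \<eta> \<noteq> 0"
  shows "Ker (plus_mult_op L q) = \<eta> *o Ker L"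
proof (cases "\<eta> = 0")
  case True
  then show ?thesis
    using nontrivial zero_in_Ker_derivation[OF deriv] by (auto simp: elt_set_times_def)
next
  case False
  have mem_iff: "\<eta> * \<phi> \<in> Ker (plus_mult_op L q) \<longleftrightarrow> \<phi> \<in> Ker L" for \<phi>
    using hom False by (simp add: Ker_def plus_mult_op_mult[OF deriv])
  show ?thesis
  proof (intro set_eqI)
    fix \<psi>
    have "\<psi> = \<eta> * (\<psi> / \<eta>)"
      using False by simp
    then show "\<psi> \<in> Ker (plus_mult_op L q) \<longleftrightarrow> \<psi> \<in> \<eta> *o Ker L"
      unfolding elt_set_times_def mem_Collect_eq using mem_iff by metis
  qed
qed

theorem mainTheorem7:
  fixes x :: "nat \<Rightarrow> 'a::{field_char_0, order}"
    and n :: nat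
    and L :: "'a \<Rightarrow> 'a"
    and q b \<chi>\<^sub>0 \<eta> :: 'a
  assumes gens_distinct: "inj_on x {1..n}"
    and gens_not_0_1: "0 \<notin> x ` {1..n}" "1 \<notin> x ` {1..n}"
    and gens_generate: "generated_subfield (x ` {1..n}) = UNIV"
    and gens_independent: "algebraically_independent_over prime_field (x ` {1..n})"
    and order_add: "\<And>\<psi>\<^sub>1 \<psi>\<^sub>2 \<phi>\<^sub>1 \<phi>\<^sub>2 :: 'a.
                      \<psi>\<^sub>1 > \<psi>\<^sub>2 \<Longrightarrow> \<phi>\<^sub>1 \<ge> \<phi>\<^sub>2 \<Longrightarrow> \<psi>\<^sub>1 + \<phi>\<^sub>1 > \<psi>\<^sub>2 + \<phi>\<^sub>2"
    and order_square: "\<And>\<psi> :: 'a. \<psi>\<^sup>2 \<ge> 0"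
    and derivation: "is_derivation_over prime_field L"
    and particular: "plus_mult_op L q \<chi>\<^sub>0 = b"
    and homogeneous: "\<eta> \<in> Ker (plus_mult_op L q)"
    and nontrivial: "Ker (plus_mult_op L q) \<noteq> {0} \<Longrightarrow> \<eta> \<noteq> 0"
  shows "{\<chi>. plus_mult_op L q \<chi> = b} = \<chi>\<^sub>0 +o Ker (plus_mult_op L q) \<and>
         \<chi>\<^sub>0 +o Ker (plus_mult_op L q) = \<chi>\<^sub>0 +o (\<eta> *o Ker L)"
proof
  have "plus_mult_op L q (\<psi> + \<phi>) = plus_mult_op L q \<psi> + plus_mult_op L q \<phi>" for \<psi> \<phi>
    using derivation by (simp add: is_derivation_over_def plus_mult_op_def algebra_simps)
  from solutions_eq_particular_plus_Ker[of "plus_mult_op L q" \<chi>\<^sub>0, OF this]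
  show "{\<chi>. plus_mult_op L q \<chi> = b} = \<chi>\<^sub>0 +o Ker (plus_mult_op L q)"
    by (simp only: particular)
  show "\<chi>\<^sub>0 +o Ker (plus_mult_op L q) = \<chi>\<^sub>0 +o (\<eta> *o Ker L)"
    using Ker_plus_mult_op[OF derivation homogeneous nontrivial] by simp
qed

end
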